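(* Let $R$ be a computable well-ordering, and let $c$ be an $R$-benign cost function. Let $Y$ be any $\omega\cdot R$-Demuth random set. Then every c.e. set $A$ that is computable from $Y$ obeys $c$.
   Context: Sets are subsets of $\omega$, identified with elements of $2^\omega$; $\lambda$ is the uniform (fair coin) measure on $2^\omega$. All computable well-orderings $R=(\omega,<_R)$ are infinite with field $\omega$ (a product order on $\omega\times\omega$ is transferred to $\omega$ by a computable bijection). The product $S\cdot R$ of linear orderings is obtained by replacing every point of $R$ by a copy of $S$, i.e. it is the right-lexicographic ordering on $S\times R$; $\omega\cdot R$ is this product with $S=(\omega,<)$. $R$-approximations: an $R$-approximation is a computable function $g=\langle g_0,g_1\rangle:\omega\times\omega\to\omega\times\omega$ such that for each $x$ and each $s>0$, if $g(x,s)\ne g(x,s-1)$ then $g_1(x,s)<_R g_1(x,s-1)$. Then $f(x)=\lim_s g_0(x,s)$ exists for all $x$, and $g$ is called an $R$-approximation to $f$. $R$-Demuth randomness: let $(W_e)_{e\in\omega}$ be an effective listing of the c.e. subsets of $2^{<\omega}$, and let $[W]^{\prec}=\{X\in2^\omega: X \text{ extends some }\sigma\in W\}$. An $R$-Demuth test is a sequence $(\mathcal L_m)_{m\in\omega}$ of c.e. open sets with $\lambda\mathcal L_m\le2^{-m}$ for all $m$, such that there is a function $f$ with an $R$-approximation and $\mathcal L_m=[W_{f(m)}]^{\prec}$ for all $m$. A set $Z$ passes the test if $Z\notin\mathcal L_m$ for almost all $m$. $Z$ is $R$-Demuth random if it passes every $R$-Demuth test. Cost functions: a cost function is a computable function $c(x,s)$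 taking non-negative rational values. It is monotone if it is nonincreasing in $x$ and nondecreasing in $s$. For a monotone cost function $c$ and a positive rational $q$, let $w_c(q,0)=0$ and, for $s>0$, let $w_c(q,s)=s$ if $c(w_c(q,s-1),s)\ge q$, and $w_c(q,s)=w_c(q,s-1)$ otherwise. A monotone cost function $c$ is $R$-benign if there is a computable function $f$ with values in $\omega$ such that $\langle w_c,f\rangle$ is an $R$-approximation (in the variables $q,s$, with positive rationals coded effectively by natural numbers). Obedience: a computable approximation to a $\Delta^0_2$ set $A$ is a uniformly computable sequence $(A_s)$ with $A_s(n)=A(n)$ for almost all $s$, for each $n$. Its total cost according to $c$ is the sum, over all stages $s>0$ for which there is some $x<s$ with $A_{s-1}(x)\ne A_s(x)$, of $c(x_s,s)$, where $x_s$ is the least such $x$. The approximation obeys $c$ if this sum is finite; a $\Delta^0_2$ set obeys $c$ if some computable approximation to it obeys $c$. *)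

theory Defs
  imports "HOL-Probability.Probability" "HOL-Library.Nat_Bijection"
begin

text \<open>
  Subsets of \<open>\<omega>\<close> are identified with their characteristic functions, i.e. with points of \<open>2\<^sup>\<omega>\<close>.
\<close>

type_synonym cantor = "nat \<Rightarrow> bool"

section \<open>Computability relative to an oracle\<close>

text \<open>
  The partial recursive functions with an oracle, presented as unary functions on \<open>\<omega>\<close>: several
  arguments are passed through the pairing function \<^const>\<open>prod_encode\<close>, whose projections and
  pairing combinator are basic operations. \<open>PrecP\<close> is primitive recursion and \<open>MuP\<close> is unbounded
  search; the identity is \<open>PairP FstP SndP\<close>.
\<close>

datatype prog =
    ZeroP | SuccP | FstP | SndP | OracleP
  | PairP prog prog | CompP prog prog | PrecP prog prog | MuP prog

primrec eval :: "cantor \<Rightarrow> prog \<Rightarrow> nat \<Rightarrow> nat option" where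
  "eval X ZeroP x = Some 0"
| "eval X SuccP x = Some (Suc x)"
| "eval X FstP x = Some (fst (prod_decode x))"
| "eval X SndP x = Some (snd (prod_decode x))"
| "eval X OracleP x = Some (of_bool (X x))"
| "eval X (PairP p q) x =
     Option.bind (eval X p x) (\<lambda>a. Option.bind (eval X q x) (\<lambda>b. Some (prod_encode (a, b))))"
| "eval X (CompP p q) x = Option.bind (eval X q x) (eval X p)"
| "eval X (PrecP p q) x =
     rec_nat (eval X p (fst (prod_decode x)))
       (\<lambda>k r. Option.bind r (\<lambda>y. eval X q (prod_encode (fst (prod_decode x), prod_encode (k, y)))))
       (snd (prod_decode x))"
| "eval X (MuP p) x =
     (if \<exists>n. eval X p (prod_encode (x, n)) = Some 0 \<and> (\<forall>i<n. eval X p (prod_encode (x, i)) \<noteq> None)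
      then Some (LEAST n. eval X p (prod_encode (x, n)) = Some 0) else None)"

text \<open>Computability without an oracle is computability relative to the empty set.\<close>

abbreviation no_oracle :: cantor where
  "no_oracle \<equiv> \<lambda>_. False"

definition computable :: "(nat \<Rightarrow> nat) \<Rightarrow> bool" where
  "computable f \<longleftrightarrow> (\<exists>p. \<forall>x. eval no_oracle p x = Some (f x))"

definition computable2 :: "(nat \<Rightarrow> nat \<Rightarrow> nat) \<Rightarrow> bool" where
  "computable2 f \<longleftrightarrow> computable (\<lambda>n. case prod_decode n of (x, y) \<Rightarrow> f x y)"

definition ce_set :: "cantor \<Rightarrow> bool" where
  "ce_set A \<longleftrightarrow> (\<exists>p. \<forall>x. A x \<longleftrightarrow> eval no_oracle p x \<noteq> None)"

definition computable_from :: "cantor \<Rightarrow> cantor \<Rightarrow> bool" where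
  "computable_from Y A \<longleftrightarrow> (\<exists>p. \<forall>x. eval Y p x = Some (of_bool (A x)))"

section \<open>C.e. sets of strings and c.e. open sets\<close>

primrec prog_encode :: "prog \<Rightarrow> nat" where
  "prog_encode ZeroP = prod_encode (0, 0)"
| "prog_encode SuccP = prod_encode (1, 0)"
| "prog_encode FstP = prod_encode (2, 0)"
| "prog_encode SndP = prod_encode (3, 0)"
| "prog_encode OracleP = prod_encode (4, 0)"
| "prog_encode (PairP p q) = prod_encode (5, prod_encode (prog_encode p, prog_encode q))"
| "prog_encode (CompP p q) = prod_encode (6, prod_encode (prog_encode p, prog_encode q))"
| "prog_encode (PrecP p q) = prod_encode (7, prod_encode (prog_encode p, prog_encode q))"
| "prog_encode (MuP p) = prod_encode (8, prog_encode p)"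

definition string_encode :: "bool list \<Rightarrow> nat" where
  "string_encode \<sigma> = list_encode (map of_bool \<sigma>)"

text \<open>
  The standard effective listing of the c.e. subsets of \<open>2\<^sup><\<^sup>\<omega>\<close>, as domains of partial
  recursive functions. The map \<^const>\<open>prog_encode\<close> is injective with decidable range, and
  \<open>W e\<close> is empty when \<open>e\<close> lies outside that range.
\<close>

definition W :: "nat \<Rightarrow> bool list set" where
  "W e = {\<sigma>. \<exists>p. prog_encode p = e \<and> eval no_oracle p (string_encode \<sigma>) \<noteq> None}"

definition extends :: "cantor \<Rightarrow> bool list \<Rightarrow> bool" where
  "extends X \<sigma> \<longleftrightarrow> (\<forall>i<length \<sigma>. X i = \<sigma> ! i)"

definition open_gen :: "bool list set \<Rightarrow> cantor set" where
  "open_gen V = {X. \<exists>\<sigma>\<in>V. extends X \<sigma>}"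

definition coin_measure :: "cantor measure" where
  "coin_measure = Pi\<^sub>M UNIV (\<lambda>_::nat. measure_pmf (bernoulli_pmf (1/2)))"

section \<open>Computable well-orderings and approximations\<close>

text \<open>
  Orderings are represented, as in the library, by their reflexive relations; \<open>R - Id\<close> is the
  strict ordering.
\<close>

definition computable_well_order :: "nat rel \<Rightarrow> bool" where
  "computable_well_order R \<longleftrightarrow>
     well_order_on UNIV R \<and> computable2 (\<lambda>x y. of_bool ((x, y) \<in> R))"

text \<open>\<open>S \<cdot> R\<close>: right-lexicographic on pairs, transferred to \<open>\<omega>\<close> by \<^const>\<open>prod_encode\<close>.\<close>

definition ord_prod :: "nat rel \<Rightarrow> nat rel \<Rightarrow> nat rel" where
  "ord_prod S R =
     {(prod_encode (a, x), prod_encode (b, y)) | a x b y.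
        (x, y) \<in> R - Id \<or> x = y \<and> (a, b) \<in> S}"

definition approximation :: "nat rel \<Rightarrow> (nat \<Rightarrow> nat \<Rightarrow> nat \<times> nat) \<Rightarrow> bool" where
  "approximation R g \<longleftrightarrow>
     computable2 (\<lambda>x s. prod_encode (g x s)) \<and>
     (\<forall>x. \<forall>s>0. g x s \<noteq> g x (s - 1) \<longrightarrow> (snd (g x s), snd (g x (s - 1))) \<in> R - Id)"

definition approximation_to :: "nat rel \<Rightarrow> (nat \<Rightarrow> nat \<Rightarrow> nat \<times> nat) \<Rightarrow> (nat \<Rightarrow> nat) \<Rightarrow> bool" where
  "approximation_to R g f \<longleftrightarrow>
     approximation R g \<and> (\<forall>x. \<forall>\<^sub>F s in sequentially. fst (g x s) = f x)"

section \<open>Demuth randomness\<close>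

definition Demuth_test :: "nat rel \<Rightarrow> (nat \<Rightarrow> cantor set) \<Rightarrow> bool" where
  "Demuth_test R L \<longleftrightarrow>
     (\<forall>m. measure coin_measure (L m) \<le> (1/2) ^ m) \<and>
     (\<exists>f g. approximation_to R g f \<and> (\<forall>m. L m = open_gen (W (f m))))"

definition passes :: "cantor \<Rightarrow> (nat \<Rightarrow> cantor set) \<Rightarrow> bool" where
  "passes Z L \<longleftrightarrow> (\<forall>\<^sub>F m in sequentially. Z \<notin> L m)"

definition Demuth_random :: "nat rel \<Rightarrow> cantor \<Rightarrow> bool" where
  "Demuth_random R Z \<longleftrightarrow> (\<forall>L. Demuth_test R L \<longrightarrow> passes Z L)"

section \<open>Cost functions\<close>

text \<open>Rationals are coded as fractions; a rational has many codes.\<close>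

definition nonneg_rat :: "nat \<Rightarrow> rat" where
  "nonneg_rat n = (case prod_decode n of (a, b) \<Rightarrow> of_nat a / of_nat (Suc b))"

definition pos_rat :: "nat \<Rightarrow> rat" where
  "pos_rat n = (case prod_decode n of (a, b) \<Rightarrow> of_nat (Suc a) / of_nat (Suc b))"

definition cost_function :: "(nat \<Rightarrow> nat \<Rightarrow> rat) \<Rightarrow> bool" where
  "cost_function c \<longleftrightarrow>
     (\<forall>x s. c x s \<ge> 0) \<and> (\<exists>h. computable2 h \<and> (\<forall>x s. c x s = nonneg_rat (h x s)))"

definition monotone_cost :: "(nat \<Rightarrow> nat \<Rightarrow> rat) \<Rightarrow> bool" where
  "monotone_cost c \<longleftrightarrow> (\<forall>s. antimono (\<lambda>x. c x s)) \<and> (\<forall>x. mono (\<lambda>s. c x s))"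

primrec w :: "(nat \<Rightarrow> nat \<Rightarrow> rat) \<Rightarrow> rat \<Rightarrow> nat \<Rightarrow> nat" where
  "w c q 0 = 0"
| "w c q (Suc s) = (if c (w c q s) (Suc s) \<ge> q then Suc s else w c q s)"

definition benign :: "nat rel \<Rightarrow> (nat \<Rightarrow> nat \<Rightarrow> rat) \<Rightarrow> bool" where
  "benign R c \<longleftrightarrow>
     cost_function c \<and> monotone_cost c \<and>
     (\<exists>f :: rat \<Rightarrow> nat \<Rightarrow> nat. approximation R (\<lambda>n s. (w c (pos_rat n) s, f (pos_rat n) s)))"

definition computable_approximation :: "(nat \<Rightarrow> cantor) \<Rightarrow> cantor \<Rightarrow> bool" where
  "computable_approximation As A \<longleftrightarrow>
     computable2 (\<lambda>s n. of_bool (As s n)) \<and> (\<forall>n. \<forall>\<^sub>F s in sequentially. As s n = A n)"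

definition stage_cost :: "(nat \<Rightarrow> nat \<Rightarrow> rat) \<Rightarrow> (nat \<Rightarrow> cantor) \<Rightarrow> nat \<Rightarrow> rat" where
  "stage_cost c As s =
     (if s > 0 \<and> (\<exists>x<s. As (s - 1) x \<noteq> As s x)
      then c (LEAST x. x < s \<and> As (s - 1) x \<noteq> As s x) s else 0)"

text \<open>
  The stage costs are nonnegative, so summability is finiteness of the total cost. A set with a
  computable approximation is \<open>\<Delta>\<^sup>0\<^sub>2\<close> by the limit lemma.
\<close>

definition obeys :: "cantor \<Rightarrow> (nat \<Rightarrow> nat \<Rightarrow> rat) \<Rightarrow> bool" where
  "obeys A c \<longleftrightarrow>
     (\<exists>As. computable_approximation As A \<and> summable (\<lambda>s. real_of_rat (stage_cost c As s)))"

end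

theory Submission
  imports Defs
begin

text \<open>
  Let \<open>A = \<Phi>(Y)\<close> be c.e. with enumeration \<open>(A\<^sub>s)\<close>, and let \<open>v(m,s) = w\<^sub>c(4\<^sup>-\<^sup>m, s)\<close>. Guess at
  stage \<open>s\<close> that the final value of \<open>A\<close> restricted to \<open>v(m) = lim\<^sub>s v(m,s)\<close> is \<open>A\<^sub>s\<close> restricted to
  \<open>v(m,s)\<close>, and let \<open>L\<^sub>m\<close> enumerate the oracles \<open>Z\<close> such that \<open>\<Phi>(Z)\<close> extends the guessed string, as
  long as their measure does not exceed \<open>2\<^sup>-\<^sup>m\<close>. While \<open>v(m,s)\<close> stays fixed the guess changes only
  finitely often, in a way bounded in advance since \<open>A\<close> is c.e.; each change of \<open>v(m,s)\<close> is a
  descent in \<open>R\<close>. Hence this is an \<open>\<omega> \<cdot> R\<close>-Demuth test. As \<open>Y\<close> passes it, for almost all \<open>m\<close> the set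
  of \<open>Z\<close> such that \<open>\<Phi>(Z)\<close> extends \<open>A\<close> restricted to \<open>v(m)\<close> has measure greater than \<open>2\<^sup>-\<^sup>m\<close>. Speed
  up the enumeration of \<open>A\<close> to stages at which this is already visible for more and more \<open>m\<close>. A
  later change of cost at least \<open>4\<^sup>-\<^sup>m\<close> happens below \<open>v(m,s)\<close>, and different such changes yield
  disjoint sets of oracles of measure greater than \<open>2\<^sup>-\<^sup>m\<close>, so there are at most \<open>2\<^sup>m\<close> of them. The
  total cost is therefore dominated by the sum of \<open>4\<^sup>-\<^sup>m \<cdot> 2\<^sup>m\<close>.
\<close>

section \<open>Closure properties of the computable functions\<close>

abbreviation p1 :: "nat \<Rightarrow> nat" where
  "p1 x \<equiv> fst (prod_decode x)"

abbreviation p2 :: "nat \<Rightarrow> nat" where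
  "p2 x \<equiv> snd (prod_decode x)"

named_theorems computable_intros

lemma computableI: "(\<And>x. eval no_oracle p x = Some (f x)) \<Longrightarrow> computable f"
  unfolding computable_def by blast

lemma computable_comp: "computable f \<Longrightarrow> computable g \<Longrightarrow> computable (\<lambda>x. f (g x))"
proof -
  assume "computable f" "computable g"
  then obtain p q where "\<And>x. eval no_oracle p x = Some (f x)" "\<And>x. eval no_oracle q x = Some (g x)"
    unfolding computable_def by blast
  then show ?thesis by (intro computableI[of "CompP p q"]) simp
qed

lemma computable_id [computable_intros]: "computable (\<lambda>x. x)"
  by (rule computableI[of "PairP FstP SndP"]) simp

lemma computable_p1 [computable_intros]:
  assumes "computable f" shows "computable (\<lambda>x. p1 (f x))"
proof -
  have "computable p1" by (rule computableI[of FstP]) simp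
  then show ?thesis using assms by (rule computable_comp)
qed

lemma computable_p2 [computable_intros]:
  assumes "computable f" shows "computable (\<lambda>x. p2 (f x))"
proof -
  have "computable p2" by (rule computableI[of SndP]) simp
  then show ?thesis using assms by (rule computable_comp)
qed

lemma computable_Suc [computable_intros]:
  assumes "computable f" shows "computable (\<lambda>x. Suc (f x))"
proof -
  have "computable Suc" by (rule computableI[of SuccP]) simp
  then show ?thesis using assms by (rule computable_comp)
qed

lemma computable_pair [computable_intros]:
  assumes "computable f" "computable g"
  shows "computable (\<lambda>x. prod_encode (f x, g x))"
proof -
  obtain p q where "\<And>x. eval no_oracle p x = Some (f x)" "\<And>x. eval no_oracle q x = Some (g x)"
    using assms unfolding computable_def by blast
  then show ?thesis by (intro computableI[of "PairP p q"]) simp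
qed

primrec constP :: "nat \<Rightarrow> prog" where
  "constP 0 = ZeroP"
| "constP (Suc n) = CompP SuccP (constP n)"

lemma eval_constP [simp]: "eval X (constP n) x = Some n"
  by (induction n) auto

lemma computable_const [computable_intros]: "computable (\<lambda>x. n)"
  by (rule computableI[of "constP n"]) simp

lemma computable_comp2:
  assumes "computable2 f" "computable g" "computable h"
  shows "computable (\<lambda>x. f (g x) (h x))"
  using computable_comp[OF assms(1)[unfolded computable2_def] computable_pair[OF assms(2,3)]]
  by simp

lemma computable2I: "computable (\<lambda>y. f (p1 y) (p2 y)) \<Longrightarrow> computable2 f"
  unfolding computable2_def by (simp add: case_prod_beta)

text \<open>\<open>PrecP\<close> is run on the pair of the whole input and the bound, so that base
  and step may both depend on \<open>x\<close>.\<close>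

lemma computable_rec_nat [computable_intros]:
  assumes "computable f" and "computable (\<lambda>y. g (p1 y) (p1 (p2 y)) (p2 (p2 y)))"
    and "computable n"
  shows "computable (\<lambda>x. rec_nat (f x) (g x) (n x))"
proof -
  obtain p q where p: "\<And>x. eval no_oracle p x = Some (f x)"
    and q: "\<And>y. eval no_oracle q y = Some (g (p1 y) (p1 (p2 y)) (p2 (p2 y)))"
    using assms(1,2) unfolding computable_def by blast
  have "rec_nat (eval no_oracle p a)
       (\<lambda>k r. Option.bind r (\<lambda>y. eval no_oracle q (prod_encode (a, prod_encode (k, y))))) m
      = Some (rec_nat (f a) (g a) m)" for a m
    by (induction m) (simp_all add: p q)
  then have "computable (\<lambda>y. rec_nat (f (p1 y)) (g (p1 y)) (p2 y))"
    by (intro computableI[of "PrecP p q"]) simp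
  from computable_comp[OF this computable_pair[OF computable_id assms(3)]]
  show ?thesis by simp
qed

lemma computable_Least_zero:
  assumes "computable (\<lambda>y. f (p1 y) (p2 y))" and "\<And>x. \<exists>n. f x n = 0"
  shows "computable (\<lambda>x. LEAST n. f x n = 0)"
proof -
  obtain p where p: "\<And>y. eval no_oracle p y = Some (f (p1 y) (p2 y))"
    using assms(1) unfolding computable_def by blast
  show ?thesis
    by (rule computableI[of "MuP p"]) (use assms(2) in \<open>simp add: p\<close>)
qed

section \<open>Arithmetic operations by primitive recursion\<close>

lemma computable_add [computable_intros]:
  assumes "computable f" "computable g"
  shows "computable (\<lambda>x. f x + g x)"
proof -
  have "rec_nat a (\<lambda>k r. Suc r) b = a + b" for a b
    by (induction b) auto
  moreover have "computable (\<lambda>x. rec_nat (f x) (\<lambda>k r. Suc r) (g x))"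
    by (intro computable_intros assms)
  ultimately show ?thesis by simp
qed

lemma computable_mult [computable_intros]:
  assumes "computable f" "computable g"
  shows "computable (\<lambda>x. f x * g x)"
proof -
  have "rec_nat 0 (\<lambda>k r. a + r) b = a * b" for a b :: nat
    by (induction b) auto
  moreover have "computable (\<lambda>x. rec_nat 0 (\<lambda>k r. f x + r) (g x))"
    by (intro computable_intros computable_comp[OF assms(1)] assms)
  ultimately show ?thesis by simp
qed

lemma computable_power [computable_intros]:
  assumes "computable f" "computable g"
  shows "computable (\<lambda>x. f x ^ g x)"
proof -
  have "rec_nat 1 (\<lambda>k r. a * r) b = a ^ b" for a b :: nat
    by (induction b) auto
  moreover have "computable (\<lambda>x. rec_nat 1 (\<lambda>k r. f x * r) (g x))"
    by (intro computable_intros computable_comp[OF assms(1)] assms)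
  ultimately show ?thesis by simp
qed

lemma computable_diff [computable_intros]:
  assumes "computable f" "computable g"
  shows "computable (\<lambda>x. f x - g x)"
proof -
  \<comment> \<open>The recursion that returns its counter is the predecessor; iterating it gives
    truncated subtraction.\<close>
  have pred: "rec_nat 0 (\<lambda>k r. k) b = b - 1" for b :: nat
    by (cases b) auto
  have "rec_nat a (\<lambda>k r. rec_nat 0 (\<lambda>k r. k) r) b = a - b" for a b :: nat
    unfolding pred by (induction b) auto
  moreover have "computable (\<lambda>x. rec_nat (f x) (\<lambda>k r. rec_nat 0 (\<lambda>k r. k) r) (g x))"
    by (intro computable_intros assms)
  ultimately show ?thesis by simp
qed

lemma computable_sum [computable_intros]:
  assumes "computable (\<lambda>y. f (p1 y) (p2 y))" "computable g"
  shows "computable (\<lambda>x. \<Sum>i<g x. f x i)"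
proof -
  have "rec_nat 0 (\<lambda>k r. f x k + r) b = (\<Sum>i<b. f x i)" for b x
    by (induction b) auto
  moreover have "computable (\<lambda>y. f (p1 y) (p1 (p2 y)))"
    using computable_comp[OF assms(1), of "\<lambda>y. prod_encode (p1 y, p1 (p2 y))"]
    by (simp add: computable_intros)
  then have "computable (\<lambda>x. rec_nat 0 (\<lambda>k r. f x k + r) (g x))"
    by (intro computable_intros assms)
  ultimately show ?thesis by simp
qed

section \<open>Decidable predicates, search, division and binary digits\<close>

definition decidable :: "(nat \<Rightarrow> bool) \<Rightarrow> bool" where
  "decidable P \<longleftrightarrow> computable (\<lambda>x. of_bool (P x))"

lemma decidable_comp: "decidable P \<Longrightarrow> computable f \<Longrightarrow> decidable (\<lambda>x. P (f x))"
  unfolding decidable_def by (rule computable_comp)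

lemma computable_of_bool [computable_intros]: "decidable P \<Longrightarrow> computable (\<lambda>x. of_bool (P x))"
  by (simp add: decidable_def)

lemma decidable_not [computable_intros]:
  assumes "decidable P" shows "decidable (\<lambda>x. \<not> P x)"
proof -
  have "of_bool (\<not> P x) = (1 - of_bool (P x) :: nat)" for x by simp
  then show ?thesis unfolding decidable_def by (simp only:) (intro computable_intros assms)
qed

lemma decidable_conj [computable_intros]:
  assumes "decidable P" "decidable Q" shows "decidable (\<lambda>x. P x \<and> Q x)"
proof -
  have "of_bool (P x \<and> Q x) = (of_bool (P x) * of_bool (Q x) :: nat)" for x by simp
  then show ?thesis unfolding decidable_def by (simp only:) (intro computable_intros assms)
qed

lemma decidable_disj [computable_intros]:
  assumes "decidable P" "decidable Q" shows "decidable (\<lambda>x. P x \<or> Q x)"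
proof -
  have "decidable (\<lambda>x. \<not> (\<not> P x \<and> \<not> Q x))" by (intro computable_intros assms)
  then show ?thesis by simp
qed

lemma decidable_imp [computable_intros]:
  assumes "decidable P" "decidable Q" shows "decidable (\<lambda>x. P x \<longrightarrow> Q x)"
proof -
  have "decidable (\<lambda>x. \<not> P x \<or> Q x)" by (intro computable_intros assms)
  then show ?thesis unfolding imp_conv_disj .
qed

lemma decidable_le [computable_intros]:
  assumes "computable f" "computable g" shows "decidable (\<lambda>x. f x \<le> g x)"
proof -
  have "of_bool (f x \<le> g x) = 1 - (f x - g x)" for x by auto
  then show ?thesis unfolding decidable_def by (simp only:) (intro computable_intros assms)
qed

lemma decidable_less [computable_intros]:
  assumes "computable f" "computable g" shows "decidable (\<lambda>x. f x < g x)"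
  using decidable_le[OF computable_Suc[OF assms(1)] assms(2)] by (simp add: Suc_le_eq)

lemma decidable_eq [computable_intros]:
  assumes "computable f" "computable g" shows "decidable (\<lambda>x. f x = g x)"
  unfolding order.eq_iff
  by (rule decidable_conj[OF decidable_le[OF assms] decidable_le[OF assms(2,1)]])

lemma computable_if [computable_intros]:
  assumes "decidable P" "computable f" "computable g"
  shows "computable (\<lambda>x. if P x then f x else g x)"
proof -
  have "(if P x then f x else g x) = of_bool (P x) * f x + of_bool (\<not> P x) * g x" for x
    by simp
  then show ?thesis by (simp only:) (intro computable_intros assms)
qed

lemma decidable_ball [computable_intros]:
  assumes "decidable (\<lambda>y. P (p1 y) (p2 y))" "computable g"
  shows "decidable (\<lambda>x. \<forall>i<g x. P x i)"
proof -
  have "(\<forall>i<g x. P x i) \<longleftrightarrow> (\<Sum>i<g x. of_bool (\<not> P x i)) \<le> (0::nat)" for x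
    by auto
  moreover have "decidable (\<lambda>x. (\<Sum>i<g x. of_bool (\<not> P x i)) \<le> (0::nat))"
    by (intro computable_intros assms)
  ultimately show ?thesis by simp
qed

lemma computable_Least [computable_intros]:
  assumes "decidable (\<lambda>y. P (p1 y) (p2 y))" and "\<And>x. \<exists>n. P x n"
  shows "computable (\<lambda>x. LEAST n. P x n)"
proof -
  have "computable (\<lambda>x. LEAST n. (of_bool (\<not> P x n) :: nat) = 0)"
    using assms by (intro computable_Least_zero computable_intros) auto
  then show ?thesis by simp
qed

lemma computable_div [computable_intros]:
  assumes "computable f" "computable g"
  shows "computable (\<lambda>x. f x div g x)"
proof -
  \<comment> \<open>The disjunct \<open>g x = 0\<close> gives the search a witness for every input,
    as \<open>computable_Least\<close> demands.\<close>
  have "f x div g x = (if g x = 0 then 0 else LEAST q. f x < g x * Suc q \<or> g x = 0)" for x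
  proof (cases "g x = 0")
    case False
    have "(LEAST q. f x < g x * Suc q \<or> g x = 0) = f x div g x"
    proof (rule Least_equality)
      show "f x < g x * Suc (f x div g x) \<or> g x = 0"
        using False dividend_less_times_div[of "g x" "f x"] by simp
      show "f x div g x \<le> q" if "f x < g x * Suc q \<or> g x = 0" for q
        using that False less_mult_imp_div_less[of "f x" "Suc q" "g x"] by (simp add: mult.commute)
    qed
    then show ?thesis using False by simp
  qed simp
  moreover have "\<exists>q. f x < g x * Suc q \<or> g x = 0" for x
    by (rule exI[of _ "f x"]) (cases "g x", auto)
  then have "computable (\<lambda>x. if g x = 0 then 0 else LEAST q. f x < g x * Suc q \<or> g x = 0)"
    by (intro computable_intros assms computable_comp[OF assms(1)] computable_comp[OF assms(2)])
  ultimately show ?thesis by simp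
qed

lemma decidable_bit [computable_intros]:
  assumes "computable f" "computable g"
  shows "decidable (\<lambda>x. bit (f x) (g x))"
proof -
  have "bit (f x) (g x) \<longleftrightarrow> 2 * (f x div 2 ^ g x div 2) \<noteq> f x div 2 ^ g x" for x
    unfolding bit_iff_odd by (metis even_two_times_div_two dvd_triv_left)
  then show ?thesis by (simp only:) (intro computable_intros assms)
qed

section \<open>Step-bounded evaluation\<close>

text \<open>
  The value \<open>0\<close> means undefined and \<open>Suc y\<close> means the value \<open>y\<close>. The bound \<open>t\<close> limits both the
  unbounded searches and the oracle queries; the remaining recursions need no bound, so that no
  universal program is required.
\<close>

primrec seval :: "nat \<Rightarrow> cantor \<Rightarrow> prog \<Rightarrow> nat \<Rightarrow> nat" where
  "seval t X ZeroP x = 1"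
| "seval t X SuccP x = Suc (Suc x)"
| "seval t X FstP x = Suc (p1 x)"
| "seval t X SndP x = Suc (p2 x)"
| "seval t X OracleP x = (if x < t then Suc (of_bool (X x)) else 0)"
| "seval t X (PairP p q) x =
     (if seval t X p x = 0 \<or> seval t X q x = 0 then 0
      else Suc (prod_encode (seval t X p x - 1, seval t X q x - 1)))"
| "seval t X (CompP p q) x =
     (if seval t X q x = 0 then 0 else seval t X p (seval t X q x - 1))"
| "seval t X (PrecP p q) x =
     rec_nat (seval t X p (p1 x))
       (\<lambda>k r. if r = 0 then 0 else seval t X q (prod_encode (p1 x, prod_encode (k, r - 1)))) (p2 x)"
| "seval t X (MuP p) x =
     (if (LEAST n. t \<le> n \<or> seval t X p (prod_encode (x, n)) \<le> 1) < t \<and>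
         seval t X p (prod_encode (x, LEAST n. t \<le> n \<or> seval t X p (prod_encode (x, n)) \<le> 1)) = 1
      then Suc (LEAST n. t \<le> n \<or> seval t X p (prod_encode (x, n)) \<le> 1) else 0)"

text \<open>The disjunct \<open>t \<le> n\<close> inside the search makes the least number exist
  without any assumption on \<open>p\<close>. Values above 1 are those of defined, nonzero
  results.\<close>

lemma seval_MuP_iff:
  "seval t X (MuP p) x = Suc n \<longleftrightarrow>
     n < t \<and> seval t X p (prod_encode (x, n)) = 1 \<and> (\<forall>i<n. 1 < seval t X p (prod_encode (x, i)))"
  (is "?L \<longleftrightarrow> ?R")
proof -
  define P where "P n \<longleftrightarrow> t \<le> n \<or> seval t X p (prod_encode (x, n)) \<le> 1" for n
  have eq: "seval t X (MuP p) x =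
    (if (LEAST n. P n) < t \<and> seval t X p (prod_encode (x, LEAST n. P n)) = 1
     then Suc (LEAST n. P n) else 0)"
    by (simp add: P_def)
  show ?thesis
  proof
    assume L: ?L
    then have n: "(LEAST n. P n) = n" "n < t" "seval t X p (prod_encode (x, n)) = 1"
      unfolding eq by (auto split: if_splits)
    have "\<not> P i" if "i < n" for i
      using not_less_Least[of i P] that n(1) by simp
    then show ?R using n(2,3) by (auto simp: P_def not_le)
  next
    assume R: ?R
    have "(LEAST n. P n) = n"
      by (rule Least_equality) (use R in \<open>auto simp: P_def not_le[symmetric]\<close>)
    then show ?L using R unfolding eq by simp
  qed
qed

lemma seval_PrecP_Suc:
  "seval t X (PrecP p q) (prod_encode (a, Suc k)) =
     (let r = seval t X (PrecP p q) (prod_encode (a, k)) in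
      if r = 0 then 0 else seval t X q (prod_encode (a, prod_encode (k, r - 1))))"
  by (simp only: seval.simps prod_encode_inverse fst_conv snd_conv old.nat.rec Let_def)

text \<open>The use principle: queries at or beyond \<open>t\<close> are undefined, so a computation
  that yields a value has consulted only oracle bits below \<open>t\<close>.\<close>

lemma seval_mono:
  assumes "seval t X p x = Suc y" and "t \<le> t'" and "\<And>i. i < t \<Longrightarrow> X i = X' i"
  shows "seval t' X' p x = Suc y"
  using assms(1)
proof (induction p arbitrary: x y)
  case OracleP
  then show ?case using assms(2,3) by (auto split: if_splits)
next
  case (PairP p q)
  then have nz: "seval t X p x \<noteq> 0" "seval t X q x \<noteq> 0"
    by (auto split: if_splits)
  then obtain a b where ab: "seval t X p x = Suc a" "seval t X q x = Suc b"
    using not0_implies_Suc by blast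
  from PairP.IH(1)[OF ab(1)] PairP.IH(2)[OF ab(2)] show ?case
    using PairP.prems ab by simp
next
  case (CompP p q)
  then have "seval t X q x \<noteq> 0"
    by (auto split: if_splits)
  then obtain b where b: "seval t X q x = Suc b"
    using not0_implies_Suc by blast
  from CompP.IH(2)[OF b] CompP.IH(1)[of b y] show ?case
    using CompP.prems b by simp
next
  case (PrecP p q)
  have "seval t' X' (PrecP p q) (prod_encode (a, m)) = Suc z"
    if "seval t X (PrecP p q) (prod_encode (a, m)) = Suc z" for a m z
    using that
  proof (induction m arbitrary: z)
    case 0
    then show ?case using PrecP.IH(1) by simp
  next
    case (Suc m)
    obtain r where r: "seval t X (PrecP p q) (prod_encode (a, m)) = Suc r"
      using Suc.prems unfolding seval_PrecP_Suc Let_def by (metis nat.distinct(1) not0_implies_Suc)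
    have "seval t X q (prod_encode (a, prod_encode (m, r))) = Suc z"
      using Suc.prems unfolding seval_PrecP_Suc Let_def r by simp
    from PrecP.IH(2)[OF this] show ?case
      unfolding seval_PrecP_Suc Let_def Suc.IH[OF r] by simp
  qed
  from this[of "p1 x" "p2 x" y] show ?case using PrecP.prems by simp
next
  case (MuP p)
  from MuP.prems have *: "y < t" "seval t X p (prod_encode (x, y)) = Suc 0"
    "\<And>i. i < y \<Longrightarrow> 1 < seval t X p (prod_encode (x, i))"
    unfolding seval_MuP_iff by auto
  have "1 < seval t' X' p (prod_encode (x, i))" if i: "i < y" for i
  proof -
    obtain v where v: "seval t X p (prod_encode (x, i)) = Suc (Suc v)"
      using less_imp_Suc_add[OF *(3)[OF i]] by auto
    show ?thesis using MuP.IH[OF v] by simp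
  qed
  then show ?case
    unfolding seval_MuP_iff using *(1,2) assms(2) MuP.IH[OF *(2)] by auto
qed auto

lemma eval_PrecP_Suc:
  "eval X (PrecP p q) (prod_encode (a, Suc k)) =
     Option.bind (eval X (PrecP p q) (prod_encode (a, k)))
       (\<lambda>y. eval X q (prod_encode (a, prod_encode (k, y))))"
  by (simp only: eval.simps prod_encode_inverse fst_conv snd_conv old.nat.rec)

lemma seval_sound: "seval t X p x = Suc y \<Longrightarrow> eval X p x = Some y"
proof (induction p arbitrary: x y)
  case (PairP p q)
  then have nz: "seval t X p x \<noteq> 0" "seval t X q x \<noteq> 0"
    by (auto split: if_splits)
  then obtain a b where ab: "seval t X p x = Suc a" "seval t X q x = Suc b"
    using not0_implies_Suc by blast
  from PairP.IH(1)[OF ab(1)] PairP.IH(2)[OF ab(2)] show ?case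
    using PairP.prems ab by simp
next
  case (CompP p q)
  then have "seval t X q x \<noteq> 0"
    by (auto split: if_splits)
  then obtain b where b: "seval t X q x = Suc b"
    using not0_implies_Suc by blast
  from CompP.IH(2)[OF b] CompP.IH(1)[of b y] show ?case
    using CompP.prems b by simp
next
  case (PrecP p q)
  have "eval X (PrecP p q) (prod_encode (a, m)) = Some z"
    if "seval t X (PrecP p q) (prod_encode (a, m)) = Suc z" for a m z
    using that
  proof (induction m arbitrary: z)
    case 0
    then show ?case using PrecP.IH(1) by simp
  next
    case (Suc m)
    obtain r where r: "seval t X (PrecP p q) (prod_encode (a, m)) = Suc r"
      using Suc.prems unfolding seval_PrecP_Suc Let_def by (metis nat.distinct(1) not0_implies_Suc)
    have "seval t X q (prod_encode (a, prod_encode (m, r))) = Suc z"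
      using Suc.prems unfolding seval_PrecP_Suc Let_def r by simp
    from PrecP.IH(2)[OF this] show ?case
      unfolding eval_PrecP_Suc Suc.IH[OF r] by simp
  qed
  from this[of "p1 x" "p2 x" y] show ?case using PrecP.prems by simp
next
  case (MuP p)
  from MuP.prems have *: "y < t" "seval t X p (prod_encode (x, y)) = Suc 0"
    "\<And>i. i < y \<Longrightarrow> 1 < seval t X p (prod_encode (x, i))"
    unfolding seval_MuP_iff by auto
  have nz: "\<exists>z. eval X p (prod_encode (x, i)) = Some (Suc z)" if i: "i < y" for i
  proof -
    obtain v where v: "seval t X p (prod_encode (x, i)) = Suc (Suc v)"
      using less_imp_Suc_add[OF *(3)[OF i]] by auto
    show ?thesis using MuP.IH[OF v] by blast
  qed
  have z: "eval X p (prod_encode (x, y)) = Some 0" by (rule MuP.IH[OF *(2)])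
  have "(LEAST n. eval X p (prod_encode (x, n)) = Some 0) = y"
  proof (rule Least_equality)
    show "y \<le> n" if "eval X p (prod_encode (x, n)) = Some 0" for n
      using nz[of n] that by (cases "n < y") auto
  qed (rule z)
  moreover have "\<exists>n. eval X p (prod_encode (x, n)) = Some 0 \<and>
      (\<forall>i<n. eval X p (prod_encode (x, i)) \<noteq> None)"
    using z nz by (intro exI[of _ y]) auto
  ultimately show ?case by simp
qed (auto split: if_splits)

text \<open>A converging computation makes finitely many queries and search steps, so every large
  bound suffices. Asking for almost all bounds lets those of the subcomputations be
  combined.\<close>

lemma seval_complete:
  "eval X p x = Some y \<Longrightarrow> \<forall>\<^sub>F t in sequentially. seval t X p x = Suc y"
proof (induction p arbitrary: x y)
  case OracleP
  then show ?case
    using eventually_gt_at_top[of x] by (auto elim: eventually_mono)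
next
  case (PairP p q)
  then obtain a b where ab: "eval X p x = Some a" "eval X q x = Some b" "y = prod_encode (a, b)"
    by (auto simp: bind_eq_Some_conv)
  from PairP.IH(1)[OF ab(1)] PairP.IH(2)[OF ab(2)] show ?case
    by eventually_elim (simp add: ab)
next
  case (CompP p q)
  then obtain b where b: "eval X q x = Some b" "eval X p b = Some y"
    by (auto simp: bind_eq_Some_conv)
  from CompP.IH(2)[OF b(1)] CompP.IH(1)[OF b(2)] show ?case
    by eventually_elim simp
next
  case (PrecP p q)
  have "\<forall>\<^sub>F t in sequentially. seval t X (PrecP p q) (prod_encode (a, m)) = Suc z"
    if "eval X (PrecP p q) (prod_encode (a, m)) = Some z" for a m z
    using that
  proof (induction m arbitrary: z)
    case 0
    then show ?case using PrecP.IH(1) by simp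
  next
    case (Suc m)
    from Suc.prems obtain r where r: "eval X (PrecP p q) (prod_encode (a, m)) = Some r"
      "eval X q (prod_encode (a, prod_encode (m, r))) = Some z"
      unfolding eval_PrecP_Suc by (auto simp: bind_eq_Some_conv)
    from Suc.IH[OF r(1)] PrecP.IH(2)[OF r(2)] show ?case
      unfolding seval_PrecP_Suc Let_def by eventually_elim simp
  qed
  from this[of "p1 x" "p2 x" y] show ?case using PrecP.prems by simp
next
  case (MuP p)
  define P where "P n \<longleftrightarrow> eval X p (prod_encode (x, n)) = Some 0" for n
  have ex: "\<exists>n. P n \<and> (\<forall>i<n. eval X p (prod_encode (x, i)) \<noteq> None)"
    and y: "y = (LEAST n. P n)"
    using MuP.prems by (auto simp: P_def split: if_splits)
  have Py: "P y" using ex LeastI_ex[of P] unfolding y by blast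
  have def: "\<exists>z. eval X p (prod_encode (x, i)) = Some (Suc z)" if "i < y" for i
  proof -
    have "\<not> P i" using not_less_Least that unfolding y by blast
    moreover obtain n where "P n" "\<forall>i<n. eval X p (prod_encode (x, i)) \<noteq> None" using ex by blast
    moreover have "y \<le> n" using \<open>P n\<close> unfolding y by (rule Least_le)
    ultimately show ?thesis using that unfolding P_def
      by (metis less_le_trans not0_implies_Suc option.exhaust)
  qed
  have "\<forall>\<^sub>F t in sequentially. 1 < seval t X p (prod_encode (x, i))" if i: "i < y" for i
  proof -
    obtain z where "eval X p (prod_encode (x, i)) = Some (Suc z)" using def[OF i] by blast
    from MuP.IH[OF this] show ?thesis by eventually_elim simp
  qed
  then have "\<forall>\<^sub>F t in sequentially. \<forall>i\<in>{..<y}. 1 < seval t X p (prod_encode (x, i))"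
    by (intro eventually_ball_finite) auto
  moreover have "\<forall>\<^sub>F t in sequentially. seval t X p (prod_encode (x, y)) = Suc 0"
    using Py MuP.IH unfolding P_def by blast
  moreover have "\<forall>\<^sub>F t in sequentially. y < t" by (rule eventually_gt_at_top)
  ultimately show ?case
    unfolding seval_MuP_iff by eventually_elim auto
qed auto

text \<open>A finite oracle is handed over as the binary digits of a number, so that it can vary
  computably with the input.\<close>

lemma computable_seval [computable_intros]:
  assumes "computable t" "computable k" "computable f"
  shows "computable (\<lambda>y. seval (t y) (bit (k y)) p (f y))"
proof -
  \<comment> \<open>Restated to generalise \<open>t\<close>, \<open>k\<close> and \<open>f\<close>
    in the induction: recursion and search call the subprograms on inputs with additional
    parameters.\<close>
  have "computable (\<lambda>y. seval (t y) (bit (k y)) p (f y))"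
    if "computable t" "computable k" "computable f" for t f and k :: "nat \<Rightarrow> nat"
    using that
  proof (induction p arbitrary: t k f)
    case (MuP p)
    have ex: "\<exists>n. t y \<le> n \<or> seval (t y) (bit (k y)) p (prod_encode (f y, n)) \<le> 1" for y
      by blast
    show ?case
      unfolding seval.simps
      by (intro computable_intros ex MuP.IH MuP.prems
          computable_comp[OF MuP.prems(1)] computable_comp[OF MuP.prems(2)]
          computable_comp[OF MuP.prems(3)])
  next
    case (PrecP p q)
    show ?case
      unfolding seval.simps
      by (intro computable_intros PrecP.IH PrecP.prems
          computable_comp[OF PrecP.prems(1)] computable_comp[OF PrecP.prems(2)]
          computable_comp[OF PrecP.prems(3)])
  next
    case (CompP p q)
    show ?case
      unfolding seval.simps by (intro computable_intros CompP.IH CompP.prems)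
  qed (unfold seval.simps, (intro computable_intros; assumption)+)
  then show ?thesis using assms .
qed

lemma computable_seval_no_oracle [computable_intros]:
  assumes "computable t" "computable f"
  shows "computable (\<lambda>y. seval (t y) no_oracle p (f y))"
proof -
  have "bit (0::nat) = no_oracle" by (simp add: fun_eq_iff)
  then show ?thesis
    using computable_seval[OF assms(1) computable_const[of 0] assms(2)] by simp
qed

section \<open>Indices of c.e. sets of strings\<close>

text \<open>This makes \<open>W\<close> at the code of a program the domain of that very
  program.\<close>

lemma prog_encode_inject: "prog_encode p = prog_encode q \<longleftrightarrow> p = q"
proof
  show "prog_encode p = prog_encode q \<Longrightarrow> p = q"
  proof (induction p arbitrary: q)
    case (PairP q q') then show ?case by (cases q) auto
  next
    case (CompP q q') then show ?case by (cases q) auto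
  next
    case (PrecP q q') then show ?case by (cases q) auto
  next
    case (MuP p) then show ?case by (cases q) auto
  qed (case_tac q; auto)+
qed simp

lemma computable_prog_encode_constP: "computable (\<lambda>z. prog_encode (constP z))"
proof -
  have "prog_encode (constP z) =
      rec_nat (prod_encode (0, 0)) (\<lambda>_ r. prod_encode (6, prod_encode (prod_encode (1, 0), r))) z" for z
    by (induction z) auto
  then show ?thesis by (simp only:) (intro computable_intros)
qed

text \<open>An s-m-n argument: the parameter is hardwired as a constant program, and the code of the
  result is computable from the parameter.\<close>

lemma ex_uniform_W_index:
  assumes "decidable (\<lambda>y. D (p1 y) (p2 y))"
  obtains ind where "computable ind" and "\<And>z. W (ind z) = {\<sigma>. D z (string_encode \<sigma>)}"
proof -
  have "computable (\<lambda>y. of_bool (\<not> D (p1 y) (p2 y)))"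
    by (intro computable_intros assms)
  then obtain p where p: "\<And>y. eval no_oracle p y = Some (of_bool (\<not> D (p1 y) (p2 y)))"
    unfolding computable_def by blast
  \<comment> \<open>The body of the search ignores the search variable through \<open>FstP\<close>:
    the search stops at once if \<open>p\<close> returns 0, that is, if \<open>D\<close> holds, and
    otherwise never.\<close>
  define Q where
    "Q z = CompP (MuP (CompP p FstP)) (PairP (constP z) (PairP FstP SndP))" for z
  have eval_Q: "eval no_oracle (Q z) x \<noteq> None \<longleftrightarrow> D z x" for z x
    by (simp add: Q_def p)
  show thesis
  proof
    show "computable (\<lambda>z. prog_encode (Q z))"
      unfolding Q_def prog_encode.simps by (intro computable_intros computable_prog_encode_constP)
    show "W (prog_encode (Q z)) = {\<sigma>. D z (string_encode \<sigma>)}" for z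
      by (simp add: W_def prog_encode_inject eval_Q[simplified])
  qed
qed

section \<open>Reading string codes arithmetically\<close>

definition code_drop :: "nat \<Rightarrow> nat \<Rightarrow> nat" where
  "code_drop x n = rec_nat x (\<lambda>_ r. p2 (r - 1)) n"

definition code_length :: "nat \<Rightarrow> nat" where
  "code_length x = (LEAST n. code_drop x n = 0)"

text \<open>The list read as a binary number with its first entry least significant, so that
  \<open>bit\<close> recovers the entries and the number can act as an oracle.\<close>

definition code_number :: "nat \<Rightarrow> nat" where
  "code_number x = (\<Sum>i<code_length x. p1 (code_drop x i - 1) * 2 ^ i)"

text \<open>A nonempty list has the code \<open>Suc (prod_encode (x, k))\<close> with
  \<open>k\<close> the code of its tail; hence the iteration of \<open>p2 (r - 1)\<close>.\<close>

lemma code_drop_list_encode: "code_drop (list_encode xs) n = list_encode (drop n xs)"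
proof (induction n)
  case 0
  then show ?case by (simp add: code_drop_def)
next
  case (Suc n)
  have "p2 (list_encode ys - 1) = list_encode (tl ys)" for ys
  proof (cases ys)
    case Nil
    \<comment> \<open>The code 0 of the empty list is left fixed, because \<open>0 - 1 = 0\<close>
      and \<open>p2 0 = 0\<close>; dropping beyond the end therefore stays at 0.\<close>
    have "prod_encode (0, 0) = 0" by (simp add: prod_encode_def)
    then have "prod_decode 0 = (0, 0)" by (metis prod_encode_inverse)
    then show ?thesis using Nil by simp
  qed simp
  then show ?case
    using Suc by (simp add: code_drop_def tl_drop drop_Suc)
qed

lemma list_encode_eq_0_iff: "list_encode xs = 0 \<longleftrightarrow> xs = []"
  by (cases xs) auto

lemma code_length_list_encode: "code_length (list_encode xs) = length xs"
  unfolding code_length_def code_drop_list_encode list_encode_eq_0_iff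
  by (rule Least_equality) auto

lemma code_length_string_encode: "code_length (string_encode \<sigma>) = length \<sigma>"
  by (simp add: string_encode_def code_length_list_encode)

lemma bit_sum_of_bool_iff: "bit (\<Sum>i<n. of_bool (P i) * 2 ^ i :: nat) j \<longleftrightarrow> j < n \<and> P j"
proof -
  have "(\<Sum>i<n. of_bool (P i) * 2 ^ i :: nat) = horner_sum of_bool 2 (map P [0..<n])"
    by (simp add: horner_sum_eq_sum atLeast0LessThan)
  then show ?thesis by (auto simp: bit_horner_sum_bit_iff)
qed

lemma code_number_string_encode:
  "bit (code_number (string_encode \<sigma>)) i \<longleftrightarrow> i < length \<sigma> \<and> \<sigma> ! i"
proof -
  have "p1 (list_encode (drop i xs) - 1) = xs ! i" if "i < length xs" for i xs
    using that by (simp add: Cons_nth_drop_Suc[symmetric])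
  then have eq: "code_number (string_encode \<sigma>) = (\<Sum>i<length \<sigma>. of_bool (\<sigma> ! i) * 2 ^ i)"
    unfolding code_number_def code_length_string_encode
    by (intro sum.cong) (simp_all add: string_encode_def code_drop_list_encode)
  show ?thesis unfolding eq by (rule bit_sum_of_bool_iff)
qed

lemma computable_code_drop [computable_intros]:
  assumes "computable f" "computable g" shows "computable (\<lambda>x. code_drop (f x) (g x))"
  unfolding code_drop_def by (intro computable_intros assms)

lemma computable_code_length [computable_intros]:
  assumes "computable f" shows "computable (\<lambda>x. code_length (f x))"
proof -
  \<comment> \<open>Every number is the code of some list, so the search for the length always
    ends.\<close>
  have ex: "\<exists>n. code_drop x n = 0" for x
    using code_drop_list_encode[of "list_decode x" "length (list_decode x)"] by auto
  have "computable code_length"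
    unfolding code_length_def by (intro computable_intros ex)
  then show ?thesis using assms by (rule computable_comp)
qed

lemma computable_code_number [computable_intros]:
  assumes "computable f" shows "computable (\<lambda>x. code_number (f x))"
proof -
  have "computable code_number"
    unfolding code_number_def by (intro computable_intros)
  then show ?thesis using assms by (rule computable_comp)
qed

section \<open>The uniform measure on Cantor space\<close>

interpretation coin: product_prob_space "\<lambda>_::nat. measure_pmf (bernoulli_pmf (1/2))" UNIV
  by unfold_locales

lemma prob_space_coin_measure: "prob_space coin_measure"
  unfolding coin_measure_def by (rule coin.P.prob_space_axioms)

interpretation coin_measure: prob_space coin_measure
  by (rule prob_space_coin_measure)

lemma measure_cylinder:
  "{Z. \<forall>i<t. Z i = X i} \<in> sets coin_measure"
  "measure coin_measure {Z. \<forall>i<t. Z i = X i} = (1/2) ^ t"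
proof -
  let ?M = "\<lambda>_::nat. measure_pmf (bernoulli_pmf (1/2))"
  have eq: "{Z. \<forall>i<t. Z i = X i} = prod_emb UNIV ?M {..<t} (\<Pi>\<^sub>E i\<in>{..<t}. {X i})"
    by (rule set_eqI) (simp add: prod_emb_def restrict_PiE_iff Pi_iff Ball_def)
  show "{Z. \<forall>i<t. Z i = X i} \<in> sets coin_measure"
    unfolding eq coin_measure_def by (rule sets_PiM_I) auto
  have "emeasure coin_measure {Z. \<forall>i<t. Z i = X i} = (\<Prod>i<t. emeasure (?M i) {X i})"
    unfolding eq coin_measure_def by (rule coin.emeasure_PiM_emb) auto
  also have "\<dots> = (\<Prod>i<t. ennreal (1/2))"
    by (intro prod.cong) (simp_all add: emeasure_pmf_single pmf_bernoulli_half)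
  also have "\<dots> = ennreal ((1/2) ^ t)"
    by (subst prod_ennreal) auto
  finally show "measure coin_measure {Z. \<forall>i<t. Z i = X i} = (1/2) ^ t"
    by (simp add: measure_def)
qed

text \<open>Together with \<open>bits_inj_below\<close>, this makes the numbers below
  \<open>2 ^ t\<close> name each pattern of \<open>t\<close> oracle bits exactly once.\<close>

lemma bit_cylinder_number: "\<exists>k<2 ^ t. \<forall>i<t. bit (k::nat) i = Z i"
  by (rule exI[of _ "horner_sum of_bool 2 (map Z [0..<t])"])
    (use horner_sum_of_bool_2_less[of "map Z [0..<t]", where ?'a = nat] in
      \<open>auto simp: bit_horner_sum_bit_iff\<close>)

lemma bits_inj_below:
  fixes k k' :: nat
  assumes "k < 2 ^ t" "k' < 2 ^ t" "\<And>i. i < t \<Longrightarrow> bit k i = bit k' i"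
  shows "k = k'"
proof -
  have "take_bit t k = take_bit t k'"
    by (rule bit_eqI) (auto simp: bit_take_bit_iff assms(3))
  then show ?thesis using assms(1,2) by (simp add: take_bit_nat_eq_self)
qed

text \<open>A property of the first \<open>t\<close> bits is a disjoint union of cylinders of
  measure \<open>(1/2) ^ t\<close>; counting them by number makes its measure computable.\<close>

lemma measure_by_counting:
  assumes "\<And>Z Z'. (\<And>i. i < t \<Longrightarrow> Z i = Z' i) \<Longrightarrow> G Z \<Longrightarrow> G Z'"
  shows "{Z. G Z} \<in> sets coin_measure"
    and "measure coin_measure {Z. G Z} = real (\<Sum>k<(2::nat) ^ t. of_bool (G (bit k))) / 2 ^ t"
proof -
  define K where "K = {k::nat. k < 2 ^ t \<and> G (bit k)}"
  define C where "C k = {Z. \<forall>i<t. Z i = bit (k::nat) i}" for k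
  have finK: "finite K" unfolding K_def by simp
  have eq: "{Z. G Z} = (\<Union>k\<in>K. C k)"
  proof (intro equalityI subsetI)
    fix Z assume "Z \<in> {Z. G Z}"
    moreover obtain k where k: "k < 2 ^ t" "\<forall>i<t. bit (k::nat) i = Z i"
      using bit_cylinder_number by blast
    ultimately have "k \<in> K" using assms[of Z "bit k"] by (auto simp: K_def)
    then show "Z \<in> (\<Union>k\<in>K. C k)" using k by (auto simp: C_def)
  next
    fix Z assume "Z \<in> (\<Union>k\<in>K. C k)"
    then show "Z \<in> {Z. G Z}" using assms[of "bit _" Z] by (auto simp: K_def C_def)
  qed
  have Csets: "C k \<in> sets coin_measure" for k unfolding C_def by (rule measure_cylinder)
  show "{Z. G Z} \<in> sets coin_measure" unfolding eq using finK Csets by auto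
  have "disjoint_family_on C K"
    unfolding disjoint_family_on_def
  proof (intro ballI impI)
    fix k k' assume "k \<in> K" "k' \<in> K" "k \<noteq> k'"
    then have "\<exists>i<t. bit k i \<noteq> bit k' i" using bits_inj_below[of k t k'] by (auto simp: K_def)
    then show "C k \<inter> C k' = {}" by (auto simp: C_def)
  qed
  then have "measure coin_measure {Z. G Z} = (\<Sum>k\<in>K. measure coin_measure (C k))"
    unfolding eq using finK Csets by (intro coin_measure.finite_measure_finite_Union) auto
  also have "\<dots> = real (card K) / 2 ^ t"
    unfolding C_def by (simp add: measure_cylinder power_divide)
  also have "card K = (\<Sum>k<(2::nat) ^ t. of_bool (G (bit k)))"
    unfolding K_def by (simp add: sum.If_cases of_bool_def Int_def)
  finally show "measure coin_measure {Z. G Z} = real (\<Sum>k<(2::nat) ^ t. of_bool (G (bit k))) / 2 ^ t" .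
qed

section \<open>The Demuth test of a reduction\<close>

text \<open>The bits of \<open>b\<close> mark the numbers below \<open>v\<close> that are outside
  the guessed set. An output not yet defined at \<open>t\<close> counts as disagreement.\<close>

definition agrees :: "prog \<Rightarrow> nat \<Rightarrow> nat \<Rightarrow> nat \<Rightarrow> cantor \<Rightarrow> bool" where
  "agrees p v b t Z \<longleftrightarrow> (\<forall>i<v. seval t Z p i = Suc (of_bool (\<not> bit b i)))"

definition agree_count :: "prog \<Rightarrow> nat \<Rightarrow> nat \<Rightarrow> nat \<Rightarrow> nat" where
  "agree_count p v b t = (\<Sum>k<(2::nat) ^ t. of_bool (agrees p v b t (bit k)))"

text \<open>
  Coding the complement makes the code of an increasing sequence of sets decrease, so that the
  code can serve as the \<open>\<omega>\<close>-component of an \<open>\<omega> \<cdot> R\<close>-approximation.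
\<close>

definition co_code :: "cantor \<Rightarrow> nat \<Rightarrow> nat" where
  "co_code S v = (\<Sum>i<v. of_bool (\<not> S i) * 2 ^ i)"

lemma bit_co_code: "bit (co_code S v) i \<longleftrightarrow> i < v \<and> \<not> S i"
  unfolding co_code_def by (rule bit_sum_of_bool_iff)

lemma agrees_co_code:
  "agrees p v (co_code S v) t Z \<longleftrightarrow> (\<forall>i<v. seval t Z p i = Suc (of_bool (S i)))"
  by (auto simp: agrees_def bit_co_code)

lemma co_code_antimono: "(\<And>x. S x \<Longrightarrow> S' x) \<Longrightarrow> co_code S' v \<le> co_code S v"
  unfolding co_code_def by (intro sum_mono mult_right_mono) auto

lemma agrees_mono:
  assumes "agrees p v b t Z" "t \<le> t'" "\<And>i. i < t \<Longrightarrow> Z i = Z' i"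
  shows "agrees p v b t' Z'"
  using assms(1) seval_mono[of t Z p _ _ t' Z'] assms(2,3) unfolding agrees_def by blast

lemma measure_agrees:
  "{Z. agrees p v b t Z} \<in> sets coin_measure"
  "measure coin_measure {Z. agrees p v b t Z} = real (agree_count p v b t) / 2 ^ t"
  unfolding agree_count_def
  using measure_by_counting[of t "agrees p v b t"] agrees_mono[OF _ order_refl] by blast+

text \<open>Turns a comparison of measures into an inequality between natural numbers, which can be
  decided.\<close>

lemma pow2_less_mult_iff:
  fixes n :: nat
  shows "2 ^ t < n * 2 ^ m \<longleftrightarrow> (1/2) ^ m < real n / 2 ^ t"
proof -
  have "2 ^ t < n * 2 ^ m \<longleftrightarrow> real (2 ^ t) < real (n * 2 ^ m)"
    by (simp only: of_nat_less_iff)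
  also have "\<dots> \<longleftrightarrow> (1/2) ^ m < real n / 2 ^ t"
    by (simp add: power_divide divide_simps)
  finally show ?thesis .
qed

text \<open>Agreement persists, so the sets of agreeing oracles grow with \<open>t\<close>, and so
  do their measures.\<close>

lemma agree_count_mono:
  assumes "2 ^ t < agree_count p v b t * 2 ^ m" "t \<le> t'"
  shows "2 ^ t' < agree_count p v b t' * 2 ^ m"
proof -
  have "measure coin_measure {Z. agrees p v b t Z} \<le> measure coin_measure {Z. agrees p v b t' Z}"
    by (intro coin_measure.finite_measure_mono measure_agrees)
      (use agrees_mono[OF _ assms(2)] in blast)
  then show ?thesis using assms(1) unfolding pow2_less_mult_iff measure_agrees by linarith
qed

text \<open>The cut-off applies stage by stage: a stage contributes all its agreeing oracles or
  none, depending on whether their measure is at most \<open>(1/2) ^ m\<close>.\<close>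

definition test_set :: "prog \<Rightarrow> nat \<Rightarrow> nat \<Rightarrow> nat \<Rightarrow> cantor set" where
  "test_set p m v b = {Z. \<exists>t. agree_count p v b t * 2 ^ m \<le> 2 ^ t \<and> agrees p v b t Z}"

text \<open>Stages are nested, so the admissible ones up to \<open>n\<close> have the last of them
  as their union, and this one meets the bound. Continuity from below gives the limit.\<close>

lemma measure_test_set: "measure coin_measure (test_set p m v b) \<le> (1/2) ^ m"
proof -
  define T where "T n = {t. t \<le> n \<and> agree_count p v b t * 2 ^ m \<le> 2 ^ t}" for n
  define V where "V n = (\<Union>t\<in>T n. {Z. agrees p v b t Z})" for n
  have finT: "finite (T n)" for n unfolding T_def by simp
  have Vsets: "V n \<in> sets coin_measure" for n
    unfolding V_def using finT measure_agrees by (intro sets.finite_UN) auto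
  have inc: "incseq V" unfolding V_def T_def incseq_def by (intro allI impI UN_mono) auto
  have eq: "test_set p m v b = (\<Union>n. V n)"
    unfolding test_set_def V_def T_def by auto
  have le: "measure coin_measure (V n) \<le> (1/2) ^ m" for n
  proof (cases "T n = {}")
    case False
    define t where "t = Max (T n)"
    have t: "t \<in> T n" unfolding t_def using finT False by (rule Max_in)
    have "V n \<subseteq> {Z. agrees p v b t Z}"
      unfolding V_def t_def using finT agrees_mono[OF _ Max_ge] by blast
    then have "measure coin_measure (V n) \<le> real (agree_count p v b t) / 2 ^ t"
      unfolding measure_agrees(2)[symmetric]
      by (intro coin_measure.finite_measure_mono measure_agrees)
    also have "\<dots> \<le> (1/2) ^ m"
      using t pow2_less_mult_iff[of t "agree_count p v b t" m] by (simp add: T_def not_less[symmetric])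
    finally show ?thesis .
  qed (simp add: V_def)
  have "(\<lambda>n. measure coin_measure (V n)) \<longlonglongrightarrow> measure coin_measure (\<Union>n. V n)"
    using Vsets inc by (intro coin_measure.finite_Lim_measure_incseq) auto
  then show ?thesis unfolding eq using le by (intro LIMSEQ_le_const2) auto
qed

section \<open>Effectiveness of the test\<close>

lemma decidable_agrees [computable_intros]:
  assumes "computable v" "computable b" "computable t" "computable k"
  shows "decidable (\<lambda>y. agrees p (v y) (b y) (t y) (bit (k y)))"
  unfolding agrees_def
  by (intro computable_intros assms assms[THEN computable_comp])

lemma computable_agree_count [computable_intros]:
  assumes "computable v" "computable b" "computable t"
  shows "computable (\<lambda>y. agree_count p (v y) (b y) (t y))"
  unfolding agree_count_def
  by (intro computable_intros assms assms[THEN computable_comp])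

lemma computable_co_code:
  assumes "decidable (\<lambda>y. E (p1 y) (p2 y))" "computable s" "computable v"
  shows "computable (\<lambda>y. co_code (E (s y)) (v y))"
proof -
  have "decidable (\<lambda>y. E (s (p1 y)) (p2 y))"
    using decidable_comp[OF assms(1), of "\<lambda>y. prod_encode (s (p1 y), p2 y)"]
    by (simp add: computable_intros computable_comp[OF assms(2)])
  then show ?thesis
    unfolding co_code_def by (intro computable_intros assms)
qed

text \<open>A string is enumerated according to the stage given by its length, with its own entries
  as oracle. Entries beyond the length do not matter by the use principle, and conversely an oracle
  that agrees at stage \<open>t\<close> is caught by its initial segment of length
  \<open>t\<close>.\<close>

lemma ex_test_index:
  obtains ind where "computable ind"
    and "\<And>m v b. open_gen (W (ind (prod_encode (m, prod_encode (v, b))))) = test_set p m v b"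
proof -
  define D where "D z x \<longleftrightarrow>
    (agree_count p (p1 (p2 z)) (p2 (p2 z)) (code_length x) * 2 ^ p1 z \<le> 2 ^ code_length x \<and>
     agrees p (p1 (p2 z)) (p2 (p2 z)) (code_length x) (bit (code_number x)))" for z x
  have "decidable (\<lambda>y. D (p1 y) (p2 y))"
    unfolding D_def by (intro computable_intros)
  then obtain ind where ind: "computable ind" "\<And>z. W (ind z) = {\<sigma>. D z (string_encode \<sigma>)}"
    using ex_uniform_W_index[of D] by blast
  have eq: "open_gen {\<sigma>. D (prod_encode (m, prod_encode (v, b))) (string_encode \<sigma>)}
      = test_set p m v b" for m v b
  proof (intro equalityI subsetI)
    fix Z assume "Z \<in> open_gen {\<sigma>. D (prod_encode (m, prod_encode (v, b))) (string_encode \<sigma>)}"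
    then obtain \<sigma> where \<sigma>: "extends Z \<sigma>"
      "agree_count p v b (length \<sigma>) * 2 ^ m \<le> 2 ^ length \<sigma>"
      "agrees p v b (length \<sigma>) (bit (code_number (string_encode \<sigma>)))"
      by (auto simp: open_gen_def D_def code_length_string_encode)
    have "agrees p v b (length \<sigma>) Z"
      using agrees_mono[OF \<sigma>(3) order_refl] \<sigma>(1)
      by (simp add: extends_def code_number_string_encode)
    then show "Z \<in> test_set p m v b" using \<sigma>(2) by (auto simp: test_set_def)
  next
    fix Z assume "Z \<in> test_set p m v b"
    then obtain t where t: "agree_count p v b t * 2 ^ m \<le> 2 ^ t" "agrees p v b t Z"
      by (auto simp: test_set_def)
    define \<sigma> where "\<sigma> = map Z [0..<t]"
    have "agrees p v b t (bit (code_number (string_encode \<sigma>)))"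
      by (rule agrees_mono[OF t(2) order_refl]) (simp add: code_number_string_encode \<sigma>_def)
    then have "D (prod_encode (m, prod_encode (v, b))) (string_encode \<sigma>)"
      using t(1) by (simp add: D_def code_length_string_encode \<sigma>_def)
    moreover have "extends Z \<sigma>" by (simp add: extends_def \<sigma>_def)
    ultimately show "Z \<in> open_gen {\<sigma>. D (prod_encode (m, prod_encode (v, b))) (string_encode \<sigma>)}"
      by (auto simp: open_gen_def)
  qed
  show thesis by (rule that[of ind]) (simp_all add: ind eq)
qed

section \<open>Limits of approximations, and the test applied to \<open>Y\<close>\<close>

lemma approximation_converges:
  assumes "approximation R g" "wf (R - Id)"
  shows "\<exists>y. \<forall>\<^sub>F s in sequentially. g x s = y"
proof -
  \<comment> \<open>Once the least rank that is ever attained has been reached, a further change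
    would descend below it.\<close>
  obtain r where r: "r \<in> range (\<lambda>s. snd (g x s))"
    "\<And>r'. (r', r) \<in> R - Id \<Longrightarrow> r' \<notin> range (\<lambda>s. snd (g x s))"
    using wfE_min[OF assms(2), of _ "range (\<lambda>s. snd (g x s))"] by blast
  then obtain s0 where s0: "r = snd (g x s0)" by blast
  have "g x s = g x s0" if "s0 \<le> s" for s
    using that
  proof (induction s rule: dec_induct)
    case (step s)
    show ?case
    proof (rule ccontr)
      assume "g x (Suc s) \<noteq> g x s0"
      then have "(snd (g x (Suc s)), snd (g x s)) \<in> R - Id"
        using assms(1) step.IH unfolding approximation_def by (metis diff_Suc_1 zero_less_Suc)
      then show False using r(2)[of "snd (g x (Suc s))"] step.IH s0 by auto
    qed
  qed simp
  then show ?thesis unfolding eventually_sequentially by blast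
qed

lemma approximation_computable2_components:
  assumes "approximation R (\<lambda>x s. (v x s, h x s))"
  shows "computable2 v" "computable2 h"
proof -
  have "computable (\<lambda>y. prod_encode (v (p1 y) (p2 y), h (p1 y) (p2 y)))"
    using assms unfolding approximation_def computable2_def by (simp add: case_prod_beta)
  from computable_p1[OF this] computable_p2[OF this] show "computable2 v" "computable2 h"
    by (auto intro: computable2I)
qed

lemma Demuth_random_agree_count:
  assumes R: "computable_well_order R"
    and Y: "Demuth_random (ord_prod natLeq R) Y"
    and v: "approximation R (\<lambda>m s. (v m s, h m s))"
    and p: "\<And>x. eval Y p x = Some (of_bool (A x))"
    and E: "decidable (\<lambda>y. E (p1 y) (p2 y))"
    and E_mono: "\<And>s s' x. s \<le> s' \<Longrightarrow> E s x \<Longrightarrow> E s' x"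
    and E_lim: "\<And>x. \<forall>\<^sub>F s in sequentially. E s x = A x"
  shows "\<forall>\<^sub>F m in sequentially. \<forall>\<^sub>F s in sequentially.
    2 ^ s < agree_count p (v m s) (co_code (E s) (v m s)) s * 2 ^ m"
proof -
  obtain ind where ind: "computable ind"
    "\<And>m v b. open_gen (W (ind (prod_encode (m, prod_encode (v, b))))) = test_set p m v b"
    using ex_test_index[of p] by blast
  have "wf (R - Id)"
    using R by (simp add: computable_well_order_def well_order_on_def)
  then have "\<forall>m. \<exists>y. \<forall>\<^sub>F s in sequentially. (v m s, h m s) = y"
    using approximation_converges[OF v] by blast
  from choice[OF this] obtain y where y: "\<And>m. \<forall>\<^sub>F s in sequentially. (v m s, h m s) = y m"
    by blast
  define vl where "vl m = fst (y m)" for m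
  have vl: "\<forall>\<^sub>F s in sequentially. v m s = vl m" for m
    using y[of m] by eventually_elim (metis fst_conv vl_def)
  define b where "b m s = co_code (E s) (v m s)" for m s
  define bl where "bl m = co_code A (vl m)" for m
  have bl: "\<forall>\<^sub>F s in sequentially. b m s = bl m" for m
  proof -
    have "\<forall>\<^sub>F s in sequentially. \<forall>i\<in>{..<vl m}. E s i = A i"
      using E_lim by (intro eventually_ball_finite) auto
    with vl[of m] show ?thesis
      by eventually_elim (simp add: b_def bl_def co_code_def)
  qed
  \<comment> \<open>The rank has the code of the guess as its \<open>\<omega>\<close> part and the
    rank \<open>h\<close> of the marker as its \<open>R\<close> part.\<close>
  define g where "g m s =
    (ind (prod_encode (m, prod_encode (v m s, b m s))), prod_encode (b m s, h m s))" for m s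
  define F where "F m = ind (prod_encode (m, prod_encode (vl m, bl m)))" for m
  have "approximation (ord_prod natLeq R) g"
    unfolding approximation_def
  proof (intro conjI allI impI)
    have "computable (\<lambda>y. v (p1 y) (p2 y))" "computable (\<lambda>y. h (p1 y) (p2 y))"
      by (intro computable_comp2[OF approximation_computable2_components(1)[OF v]]
          computable_comp2[OF approximation_computable2_components(2)[OF v]] computable_intros)+
    then show "computable2 (\<lambda>m s. prod_encode (g m s))"
      unfolding g_def b_def
      by (intro computable2I computable_intros computable_comp[OF ind(1)] computable_co_code[OF E])
  next
    fix m s :: nat
    assume s: "0 < s" and neq: "g m s \<noteq> g m (s - 1)"
    show "(snd (g m s), snd (g m (s - 1))) \<in> ord_prod natLeq R - Id"
    proof (cases "(v m s, h m s) = (v m (s - 1), h m (s - 1))")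
      case True
      \<comment> \<open>With the marker at rest, newly enumerated elements only delete bits of the
        complement code.\<close>
      have "b m s \<le> b m (s - 1)"
        unfolding b_def using True by (auto intro!: co_code_antimono E_mono[of "s - 1" s])
      moreover have "b m s \<noteq> b m (s - 1)" using neq True by (auto simp: g_def)
      ultimately show ?thesis using True by (auto simp: g_def ord_prod_def natLeq_def)
    next
      case False
      \<comment> \<open>Here the guess code may jump upwards, which is harmless since the
        \<open>R\<close> part dominates.\<close>
      then have "(h m s, h m (s - 1)) \<in> R - Id"
        using v[unfolded approximation_def, THEN conjunct2, rule_format, OF s False] by simp
      then show ?thesis by (auto simp: g_def ord_prod_def)
    qed
  qed
  moreover have "\<forall>\<^sub>F s in sequentially. fst (g m s) = F m" for m
    using vl[of m] bl[of m] by eventually_elim (simp add: g_def F_def)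
  moreover have "test_set p m (vl m) (bl m) = open_gen (W (F m))" for m
    by (simp add: F_def ind(2))
  ultimately have "Demuth_test (ord_prod natLeq R) (\<lambda>m. test_set p m (vl m) (bl m))"
    unfolding Demuth_test_def approximation_to_def
    using measure_test_set by blast
  then have "\<forall>\<^sub>F m in sequentially. Y \<notin> test_set p m (vl m) (bl m)"
    using Y by (auto simp: Demuth_random_def passes_def)
  then show ?thesis
  proof eventually_elim
    case (elim m)
    \<comment> \<open>Since \<open>Y\<close> computes \<open>A\<close>, it agrees with the final
      guess at some stage; being outside the test set, it must have been stopped there by the
      cut-off.\<close>
    have "\<forall>\<^sub>F t in sequentially. \<forall>i\<in>{..<vl m}. seval t Y p i = Suc (of_bool (A i))"
      using seval_complete[OF p] by (intro eventually_ball_finite) auto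
    then have "\<forall>\<^sub>F t in sequentially. agrees p (vl m) (bl m) t Y"
      by eventually_elim (auto simp: bl_def agrees_co_code)
    then obtain t0 where "agrees p (vl m) (bl m) t0 Y"
      by (auto simp: eventually_sequentially)
    then have "2 ^ t0 < agree_count p (vl m) (bl m) t0 * 2 ^ m"
      using elim by (auto simp: test_set_def not_le)
    then have "\<forall>\<^sub>F s in sequentially. 2 ^ s < agree_count p (vl m) (bl m) s * 2 ^ m"
      using agree_count_mono unfolding eventually_sequentially by blast
    with vl[of m] bl[of m] show ?case
      by eventually_elim (simp add: b_def)
  qed
qed

section \<open>Bounding the total cost\<close>

lemma w_le: "w c q s \<le> s"
  by (induction s) auto

lemma w_mono: "s \<le> s' \<Longrightarrow> w c q s \<le> w c q s'"
proof (induction s' rule: dec_induct)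
  case (step s')
  then show ?case using w_le[of c q s'] by auto
qed simp

text \<open>Either the marker moves to \<open>n\<close> at stage \<open>n\<close>, or the cost at
  its old place is below \<open>q\<close>, and then monotonicity in the first argument puts
  \<open>x\<close> below that place.\<close>

lemma less_w:
  assumes "monotone_cost c" "x < n" "q \<le> c x n"
  shows "x < w c q n"
proof (cases n)
  case (Suc s)
  show ?thesis
  proof (rule ccontr)
    assume *: "\<not> x < w c q n"
    then have "c (w c q s) n < q" using Suc assms(2) by (auto split: if_splits)
    moreover from this * have "w c q s \<le> x" using Suc by simp
    then have "c x n \<le> c (w c q s) n"
      using assms(1) unfolding monotone_cost_def antimono_def by blast
    ultimately show False using assms(3) by simp
  qed
qed (use assms(2) in simp)

lemma stage_cost_nonneg: "cost_function c \<Longrightarrow> 0 \<le> stage_cost c B n"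
  by (simp add: stage_cost_def cost_function_def)

text \<open>Positivity of \<open>q\<close> rules out the default cost 0 of a stage without
  change.\<close>

lemma stage_cost_geE:
  assumes "q \<le> stage_cost c B n" "0 < q"
  obtains x where "x < n" "B (n - 1) x \<noteq> B n x" "q \<le> c x n"
proof -
  have ex: "0 < n" "\<exists>x. x < n \<and> B (n - 1) x \<noteq> B n x"
    using assms by (auto simp: stage_cost_def split: if_splits)
  show thesis
    by (rule that[of "LEAST x. x < n \<and> B (n - 1) x \<noteq> B n x"])
      (use LeastI_ex[OF ex(2)] assms ex in \<open>auto simp: stage_cost_def\<close>)
qed

lemma card_large_stage_costs:
  fixes S :: "nat \<Rightarrow> nat" and E :: "nat \<Rightarrow> cantor"
  assumes c: "monotone_cost c" and q: "0 < q"
    and E_mono: "\<And>s s' x. s \<le> s' \<Longrightarrow> E s x \<Longrightarrow> E s' x"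
    and S: "strict_mono S" "\<And>n. n < S n"
    and count: "\<And>n. m < n \<Longrightarrow>
      2 ^ S n < agree_count p (w c q (S n)) (co_code (E (S n)) (w c q (S n))) (S n) * 2 ^ m"
    and F: "finite F" "F \<subseteq> {n. m + 1 < n \<and> q \<le> stage_cost c (\<lambda>n. E (S n)) n}"
  shows "card F \<le> 2 ^ m"
proof -
  define v where "v n = w c q (S n)" for n
  \<comment> \<open>The guess is taken just before change \<open>n\<close>, when the number about to
    enter is still absent.\<close>
  define D where "D n = {Z. agrees p (v (n - 1)) (co_code (E (S (n - 1))) (v (n - 1))) (S (n - 1)) Z}" for n
  have Dsets: "D n \<in> sets coin_measure" for n
    unfolding D_def by (rule measure_agrees)
  have S_mono: "S n \<le> S n'" if "n \<le> n'" for n n'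
    using S(1) that by (simp add: strict_mono_less_eq)
  have v_mono: "v n \<le> v n'" if "n \<le> n'" for n n'
    unfolding v_def by (intro w_mono S_mono that)
  have "D n \<inter> D n' = {}" if n: "n \<in> F" and n': "n' \<in> F" and less: "n < n'" for n n'
  proof (rule ccontr)
    assume "D n \<inter> D n' \<noteq> {}"
    then obtain Z where Z: "Z \<in> D n" "Z \<in> D n'" by blast
    obtain x where x: "x < n" "E (S (n - 1)) x \<noteq> E (S n) x" "q \<le> c x n"
      using stage_cost_geE[of q c "\<lambda>n. E (S n)" n] F(2) n q by blast
    have E: "\<not> E (S (n - 1)) x" "E (S n) x"
      using E_mono[OF S_mono[of "n - 1" n], of x] x(2) by auto
    have E': "E (S (n' - 1)) x"
      by (rule E_mono[OF S_mono E(2)]) (use less in simp)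
    \<comment> \<open>The change is charged at \<open>n\<close>, the index of the accelerated stage,
      so its cost bounds \<open>x\<close> by the marker at \<open>n\<close>. As
      \<open>n \<le> S (n - 1)\<close>, the marker used in \<open>D n\<close> is at least as
      large.\<close>
    have "n \<le> S (n - 1)" using S(2)[of "n - 1"] by simp
    then have xv: "x < v (n - 1)"
      using less_w[OF c x(1,3)] w_mono unfolding v_def by (meson less_le_trans)
    moreover have "v (n - 1) \<le> v (n' - 1)"
      by (rule v_mono) (use less in simp)
    ultimately have xv': "x < v (n' - 1)" by (rule less_le_trans)
    \<comment> \<open>A common oracle would output 0 at \<open>x\<close> before \<open>x\<close> is
      enumerated and 1 afterwards; the use principle carries the first value to the later
      stage.\<close>
    have "seval (S (n - 1)) Z p x = Suc 0"
      using Z(1) xv E(1) unfolding D_def agrees_co_code by simp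
    then have "seval (S (n' - 1)) Z p x = Suc 0"
      by (rule seval_mono) (use less in \<open>auto intro: S_mono\<close>)
    moreover have "seval (S (n' - 1)) Z p x = Suc 1"
      using Z(2) xv' E' unfolding D_def agrees_co_code by simp
    ultimately show False by simp
  qed
  then have "disjoint_family_on D F"
    unfolding disjoint_family_on_def by (metis inf_commute nat_neq_iff)
  then have "(\<Sum>n\<in>F. measure coin_measure (D n)) = measure coin_measure (\<Union>n\<in>F. D n)"
    using F(1) Dsets by (intro coin_measure.finite_measure_finite_Union[symmetric]) auto
  also have "\<dots> \<le> 1" by (rule coin_measure.prob_le_1)
  finally have "(\<Sum>n\<in>F. measure coin_measure (D n)) \<le> 1" .
  moreover have "(1/2) ^ m \<le> measure coin_measure (D n)" if "n \<in> F" for n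
  proof -
    \<comment> \<open>The guess stems from the preceding index, hence the condition
      \<open>m + 1 < n\<close> rather than \<open>m < n\<close>.\<close>
    have "m < n - 1" using F(2) that by auto
    from count[OF this] show ?thesis
      unfolding D_def measure_agrees pow2_less_mult_iff v_def by simp
  qed
  then have "(\<Sum>n\<in>F. (1/2) ^ m) \<le> (\<Sum>n\<in>F. measure coin_measure (D n))"
    by (rule sum_mono)
  ultimately have "real (card F) * (1/2) ^ m \<le> 1" by simp
  then have "real (card F) \<le> real (2 ^ m)" by (simp add: power_divide divide_simps)
  then show ?thesis by (simp only: of_nat_le_iff)
qed

text \<open>Terms between \<open>(1/4) ^ m\<close> and \<open>4 * (1/4) ^ m\<close> form a layer of
  at most \<open>2 ^ m\<close> elements, which contributes at most \<open>4 * (1/2) ^ m\<close>.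
  Late terms that the condition \<open>m + 1 < n\<close> keeps out of all layers are below a
  geometric series.\<close>

lemma summable_if_few_large:
  fixes a :: "nat \<Rightarrow> real"
  assumes nonneg: "\<And>n. 0 \<le> a n"
    and few: "\<And>m F. m0 \<le> m \<Longrightarrow> finite F \<Longrightarrow> F \<subseteq> {n. m + 1 < n \<and> (1/4) ^ m \<le> a n} \<Longrightarrow> card F \<le> 2 ^ m"
  shows "summable a"
proof -
  define N where "N m = {n. m + 1 < n \<and> (1/4) ^ m \<le> a n}" for m
  have N: "finite (N m) \<and> card (N m) \<le> 2 ^ m" if "m0 \<le> m" for m
    by (rule finite_if_finite_subsets_card_bdd) (use few[OF that] in \<open>auto simp: N_def\<close>)
  \<comment> \<open>Only finitely many terms are erased; each remaining one is below
    \<open>(1/4) ^ m0\<close>, so its layer has an index above \<open>m0\<close>, where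
    \<open>few\<close> applies.\<close>
  define a' where "a' n = (if n \<le> m0 + 2 \<or> n \<in> N m0 then 0 else a n)" for n
  define h where "h m n = (if m0 \<le> m \<and> n \<in> N m then 4 * (1/4) ^ m else 0 :: real)" for m n
  have h_nonneg: "0 \<le> h m n" for m n by (simp add: h_def)
  have a'_le: "a' n \<le> 16 * (1/4) ^ n + (\<Sum>m<n. h m n)" for n
  \<comment> \<open>For \<open>n \<ge> 2\<close>, the largest \<open>m\<close> with
    \<open>m + 1 < n\<close> is \<open>n - 2\<close>; the factor 16 comes from this shift by
    2.\<close>
  proof (cases "a' n = 0 \<or> a n < (1/4) ^ (n - 2)")
    case True
    have "a' n \<le> 16 * (1/4) ^ n"
    proof (cases "a' n = 0")
      case False
      then have n: "a' n = a n" "2 \<le> n" by (auto simp: a'_def split: if_splits)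
      from n(2) obtain k where "n = 2 + k" using le_Suc_ex by blast
      then have "(1/4 :: real) ^ n = (1/4) ^ (n - 2) * (1/4) ^ 2"
        by (simp only: power_add add_diff_cancel_left' mult.commute)
      moreover have "a n < (1/4) ^ (n - 2)" using True False by simp
      ultimately show ?thesis using n(1) by (simp add: power2_eq_square)
    qed simp
    then show ?thesis using sum_nonneg[of "{..<n}" "\<lambda>m. h m n"] h_nonneg by fastforce
  next
    case False
    then have n: "m0 + 2 < n" "n \<notin> N m0" "a' n = a n" "(1/4) ^ (n - 2) \<le> a n"
      by (auto simp: a'_def split: if_splits)
    have small: "a n < (1/4) ^ m0" using n(1,2) by (auto simp: N_def not_le)
    define m where "m = (LEAST m. (1/4) ^ m \<le> a n)"
    have m: "(1/4) ^ m \<le> a n" "m \<le> n - 2"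
      unfolding m_def using n(4) by (auto intro: LeastI Least_le)
    have "m0 < m"
    proof (rule ccontr)
      assume "\<not> m0 < m"
      then have "(1/4 :: real) ^ m0 \<le> (1/4) ^ m" by (intro power_decreasing) auto
      then show False using m(1) small by linarith
    qed
    then obtain k where k: "m = Suc k" using less_imp_Suc_add by blast
    have "\<not> (1/4) ^ k \<le> a n"
      using not_less_Least[of k "\<lambda>m. (1/4) ^ m \<le> a n"] k unfolding m_def by simp
    then have "a n \<le> 4 * (1/4) ^ m" using k by simp
    also have "\<dots> = h m n"
      using \<open>m0 < m\<close> m n(1) by (simp add: h_def N_def)
    also have "\<dots> \<le> (\<Sum>m<n. h m n)"
      by (rule member_le_sum) (use m(2) n(1) h_nonneg in auto)
    finally show ?thesis using n(3) by (simp add: add_increasing)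
  qed
  have geometric: "(\<Sum>n<M. r ^ n) \<le> 1 / (1 - r)" if "0 < r" "r < 1" for r :: real and M
    using sum_le_suminf[of "\<lambda>n. r ^ n" "{..<M}"] that by (simp add: suminf_geometric summable_geometric)
  have h_sum: "(\<Sum>n<M. h m n) \<le> 4 * (1/2) ^ m" for m M
  proof (cases "m0 \<le> m")
    case True
    have "(\<Sum>n<M. h m n) = (\<Sum>n\<in>{..<M} \<inter> N m. 4 * (1/4) ^ m)"
      using True by (simp add: h_def sum.If_cases Int_def)
    also have "\<dots> = real (card ({..<M} \<inter> N m)) * (4 * (1/4) ^ m)" by simp
    also have "\<dots> \<le> real (2 ^ m) * (4 * (1/4) ^ m)"
    proof (rule mult_right_mono)
      have "card ({..<M} \<inter> N m) \<le> 2 ^ m"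
        using N[OF True] card_mono[of "N m" "{..<M} \<inter> N m"] by (meson Int_lower2 order_trans)
      then show "real (card ({..<M} \<inter> N m)) \<le> real (2 ^ m)" by (simp only: of_nat_le_iff)
    qed simp
    also have "\<dots> = 4 * (2 * (1/4)) ^ m" by (simp only: power_mult_distrib) simp
    finally show ?thesis by simp
  qed (simp add: h_def)
  \<comment> \<open>The geometric series give at most \<open>16 * (4/3)\<close>, which is below 32,
    for the terms outside the layers and \<open>4 * 2\<close> for the layers.\<close>
  have "(\<Sum>n<M. a' n) \<le> 32 + 8" for M
  proof -
    have "(\<Sum>n<M. \<Sum>m<n. h m n) \<le> (\<Sum>n<M. \<Sum>m<M. h m n)"
      by (intro sum_mono sum_mono2) (auto simp: h_nonneg)
    also have "\<dots> = (\<Sum>m<M. \<Sum>n<M. h m n)" by (rule sum.swap)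
    also have "\<dots> \<le> (\<Sum>m<M. 4 * (1/2) ^ m)" by (intro sum_mono h_sum)
    also have "\<dots> \<le> 8" using geometric[of "1/2" M] by (simp add: sum_distrib_left[symmetric])
    finally have "(\<Sum>n<M. \<Sum>m<n. h m n) \<le> 8" .
    moreover have "(\<Sum>n<M. 16 * (1/4 :: real) ^ n) \<le> 32"
      using geometric[of "1/4" M] by (simp add: sum_distrib_left[symmetric])
    moreover have "(\<Sum>n<M. a' n) \<le> (\<Sum>n<M. 16 * (1/4) ^ n + (\<Sum>m<n. h m n))"
      by (intro sum_mono a'_le)
    ultimately show ?thesis by (simp add: sum.distrib)
  qed
  then have "summable a'"
    using nonneg by (intro summableI_nonneg_bounded[of a' "32 + 8"]) (auto simp: a'_def)
  moreover have "finite (N m0 \<union> {..m0 + 2})" using N by simp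
  then have "\<forall>\<^sub>F n in sequentially. n \<notin> N m0 \<union> {..m0 + 2}"
    by (simp add: cofinite_eq_sequentially[symmetric] eventually_cofinite del: Un_iff)
  then have "\<forall>\<^sub>F n in sequentially. a' n = a n"
    by eventually_elim (auto simp: a'_def)
  ultimately show ?thesis using summable_cong by blast
qed

section \<open>Enumeration of \<open>A\<close> and its acceleration\<close>

lemma ce_set_enumeration:
  assumes "ce_set A"
  obtains E where "decidable (\<lambda>y. E (p1 y) (p2 y))"
    and "\<And>s s' x. s \<le> s' \<Longrightarrow> E s x \<Longrightarrow> E s' x"
    and "\<And>x. \<forall>\<^sub>F s in sequentially. E s x = A x"
proof -
  obtain q where q: "\<And>x. A x \<longleftrightarrow> eval no_oracle q x \<noteq> None"
    using assms unfolding ce_set_def by blast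
  define E where "E s x \<longleftrightarrow> seval s no_oracle q x \<noteq> 0" for s x
  show thesis
  proof
    show "decidable (\<lambda>y. E (p1 y) (p2 y))"
      unfolding E_def by (intro computable_intros)
    show "E s' x" if "s \<le> s'" "E s x" for s s' x
      using that seval_mono[of s no_oracle q x _ s' no_oracle] not0_implies_Suc
      unfolding E_def by (metis nat.distinct(1))
    show "\<forall>\<^sub>F s in sequentially. E s x = A x" for x
    proof (cases "A x")
      case True
      then obtain y where "eval no_oracle q x = Some y" using q by blast
      from seval_complete[OF this] show ?thesis
        using True by (auto simp: E_def elim!: eventually_mono)
    next
      case False
      then have "\<not> E s x" for s
        using q[of x] seval_sound[of s no_oracle q x] not0_implies_Suc unfolding E_def by blast
      then show ?thesis using False by simp
    qed
  qed
qed

theorem theorem7p12: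
  fixes R :: "nat rel" and c :: "nat \<Rightarrow> nat \<Rightarrow> rat" and Y A :: cantor
  assumes "computable_well_order R"
    and "benign R c"
    and "Demuth_random (ord_prod natLeq R) Y"
    and "ce_set A"
    and "computable_from Y A"
  shows "obeys A c"
proof -
  obtain p where p: "\<And>x. eval Y p x = Some (of_bool (A x))"
    using assms(5) unfolding computable_from_def by blast
  obtain E where E: "decidable (\<lambda>y. E (p1 y) (p2 y))"
    and E_mono: "\<And>s s' x. s \<le> s' \<Longrightarrow> E s x \<Longrightarrow> E s' x"
    and E_lim: "\<And>x. \<forall>\<^sub>F s in sequentially. E s x = A x"
    using ce_set_enumeration[OF assms(4)] by blast
  obtain f :: "rat \<Rightarrow> nat \<Rightarrow> nat" where c: "cost_function c" "monotone_cost c"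
    and f: "approximation R (\<lambda>n s. (w c (pos_rat n) s, f (pos_rat n) s))"
    using assms(2) unfolding benign_def by blast
  \<comment> \<open>\<open>pos_rat\<close> adds 1 to numerator and denominator, so this pair codes
    \<open>(1/4) ^ m\<close>.\<close>
  define code where "code m = prod_encode (0, 4 ^ m - 1)" for m :: nat
  have pos_rat_code: "pos_rat (code m) = (1/4) ^ m" for m
  proof -
    have "of_nat (Suc (4 ^ m - 1)) = (4 ^ m :: rat)" by simp
    then show ?thesis by (simp add: pos_rat_def code_def power_divide)
  qed
  define v where "v m s = w c (pos_rat (code m)) s" for m s
  have v: "approximation R (\<lambda>m s. (v m s, f (pos_rat (code m)) s))"
    unfolding approximation_def
  proof (intro conjI allI impI)
    have code: "computable (\<lambda>y. code (p1 y))"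
      unfolding code_def by (intro computable_intros)
    have "computable2 (\<lambda>n s. prod_encode (w c (pos_rat n) s, f (pos_rat n) s))"
      using f unfolding approximation_def by simp
    from computable_comp2[OF this code computable_p2[OF computable_id]]
    show "computable2 (\<lambda>m s. prod_encode (v m s, f (pos_rat (code m)) s))"
      by (intro computable2I) (simp add: v_def)
  qed (use f[unfolded approximation_def, THEN conjunct2] in \<open>unfold v_def, blast\<close>)
  define Q where "Q m s \<longleftrightarrow> 2 ^ s < agree_count p (v m s) (co_code (E s) (v m s)) s * 2 ^ m" for m s
  have "\<forall>\<^sub>F m in sequentially. \<forall>\<^sub>F s in sequentially. Q m s"
    unfolding Q_def by (rule Demuth_random_agree_count[OF assms(1,3) v p E E_mono E_lim])
  then obtain m0 where m0: "\<And>m. m0 \<le> m \<Longrightarrow> \<forall>\<^sub>F s in sequentially. Q m s"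
    unfolding eventually_sequentially[of "\<lambda>m. eventually (Q m) sequentially"] by blast
  \<comment> \<open>Only finitely many \<open>m\<close> are tested, so the search ends. It is
    computable because \<open>m0\<close> is a fixed number, even if it is not found
    effectively.\<close>
  define next_stage where
    "next_stage n r = (LEAST s. r < s \<and> (\<forall>m<Suc n. m0 \<le> m \<longrightarrow> Q m s))" for n r
  have ex: "\<exists>s. r < s \<and> (\<forall>m<Suc n. m0 \<le> m \<longrightarrow> Q m s)" for n r
  proof -
    have "\<forall>\<^sub>F s in sequentially. \<forall>m\<in>{..<Suc n}. m0 \<le> m \<longrightarrow> Q m s"
      using m0 by (intro eventually_ball_finite) auto
    then have "\<forall>\<^sub>F s in sequentially. r < s \<and> (\<forall>m\<in>{..<Suc n}. m0 \<le> m \<longrightarrow> Q m s)"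
      by (intro eventually_conj eventually_gt_at_top)
    then show ?thesis unfolding eventually_sequentially by auto
  qed
  \<comment> \<open>The initial value 1 secures \<open>n < S n\<close> already for
    \<open>n = 0\<close>.\<close>
  define S where "S n = rec_nat 1 next_stage n" for n
  have next_stage: "r < next_stage n r" "m0 \<le> m \<Longrightarrow> m < Suc n \<Longrightarrow> Q m (next_stage n r)" for n r m
    using LeastI_ex[OF ex[of r n]] unfolding next_stage_def by blast+
  have S_simps: "S 0 = 1" "S (Suc n) = next_stage n (S n)" for n
    by (simp_all add: S_def)
  have S_mono: "strict_mono S"
    unfolding strict_mono_Suc_iff S_simps using next_stage by blast
  have S_gt: "n < S n" for n
  proof (induction n)
    case (Suc n)
    then show ?case using next_stage(1)[of "S n" n] unfolding S_simps by linarith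
  qed (simp add: S_simps)
  \<comment> \<open>The stage \<open>S (Suc n)\<close> was tested for all \<open>m \<le> n\<close>
    from \<open>m0\<close> on, which gives the strict bound \<open>m < n\<close> after the shift of
    index.\<close>
  have S_Q: "Q m (S n)" if "m0 \<le> m" "m < n" for m n
    using that next_stage(2) by (cases n) (auto simp: S_simps)
  have computable_v: "computable2 v"
    using approximation_computable2_components[OF v] by blast
  have decidable_Q: "decidable (\<lambda>y. Q (f y) (g y))" if "computable f" "computable g" for f g
    unfolding Q_def
    by (intro computable_intros computable_comp2[OF computable_v] computable_co_code[OF E] that)
  have computable_next: "computable (\<lambda>y. next_stage (f y) (g y))"
    if "computable f" "computable g" for f g
    unfolding next_stage_def
    by (intro computable_intros decidable_Q ex that that[THEN computable_comp])
  have computable_S: "computable (\<lambda>y. S (f y))" if "computable f" for f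
    unfolding S_def by (intro computable_intros computable_next that)
  define B where "B n = E (S n)" for n
  have "computable_approximation B A"
    unfolding computable_approximation_def
  proof (intro conjI allI)
    have "computable (\<lambda>y. prod_encode (S (p1 y), p2 y))"
      by (intro computable_intros computable_S)
    from decidable_comp[OF E this]
    show "computable2 (\<lambda>s n. of_bool (B s n))"
      unfolding B_def by (intro computable2I computable_intros) simp
    show "\<forall>\<^sub>F s in sequentially. B s n = A n" for n
      unfolding B_def
      using eventually_compose_filterlim[OF E_lim filterlim_subseq[OF S_mono]] .
  qed
  moreover have "summable (\<lambda>n. real_of_rat (stage_cost c B n))"
  proof (rule summable_if_few_large[of _ m0])
    show "0 \<le> real_of_rat (stage_cost c B n)" for n
      using stage_cost_nonneg[OF c(1)] by simp
    fix m F
    assume m: "m0 \<le> m" and F: "finite F" "F \<subseteq> {n. m + 1 < n \<and> (1/4) ^ m \<le> real_of_rat (stage_cost c B n)}"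
    have "(1/4) ^ m \<le> real_of_rat r \<longleftrightarrow> (1/4) ^ m \<le> r" for r
    proof -
      have "(1/4) ^ m = real_of_rat ((1/4) ^ m)" by (simp add: of_rat_power of_rat_divide)
      then show ?thesis by (simp only: of_rat_less_eq)
    qed
    with F(2) have F': "F \<subseteq> {n. m + 1 < n \<and> (1/4) ^ m \<le> stage_cost c (\<lambda>n. E (S n)) n}"
      by (simp add: B_def[abs_def])
    show "card F \<le> 2 ^ m"
      by (rule card_large_stage_costs[OF c(2) _ E_mono S_mono S_gt _ F(1) F'])
        (use S_Q[OF m] in \<open>auto simp: Q_def v_def pos_rat_code\<close>)
  qed
  ultimately show ?thesis unfolding obeys_def by blast
qed

end
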